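(* Let $\mathbf{N}$ denote the set of positive integers and $\mathbf{Q}$ the set of rational numbers. If $f:\mathbf{N} \rightarrow \mathbf{Q}$ is surjective, then for no positive integer $k$ is $f$ $k$-monotonic; that is, for every positive integer $k$ there do not exist subsets $X_1, \ldots, X_k \subseteq \mathbf{N}$ with $\mathbf{N} = X_1 \cup \cdots \cup X_k$ such that for each $i = 1, \ldots, k$ the restriction $f|X_i$ is monotonically increasing or monotonically decreasing.
   Context: A function $g: A \rightarrow B$ between ordered sets is monotonically increasing if $x \leq x'$ implies $g(x) \leq g(x')$, and monotonically decreasing if $x \leq x'$ implies $g(x) \geq g(x')$. The function $f$ is called $k$-monotonic if its domain is a union of $k$ subsets on each of which $f$ is monotonically increasing or monotonically decreasing. *)

theory Defs
  imports Complex_Main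
begin

definition k_monotonic_on :: "nat \<Rightarrow> 'a::order set \<Rightarrow> ('a \<Rightarrow> 'b::order) \<Rightarrow> bool" where
  "k_monotonic_on k D f \<longleftrightarrow>
     (\<exists>X :: nat \<Rightarrow> 'a set. D = (\<Union>i\<in>{1..k}. X i) \<and>
        (\<forall>i\<in>{1..k}. mono_on (X i) f \<or> antimono_on (X i) f))"

end

theory Submission
  imports Defs
begin

text \<open>
  If \<open>f\<close> is monotone on a set \<open>X\<close> of naturals and takes a value \<open>f x\<close> in an open interval,
  then only the finitely many points of \<open>X\<close> below \<open>x\<close> can take values on one fixed side of
  \<open>f x\<close>. So the image of \<open>X\<close> is nowhere dense, and finitely many such images
  cannot cover the rationals.
\<close>

text \<open>The gap starts at the largest point of \<open>S\<close> in the interval, or at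
  \<open>a\<close> if there is none; inserting \<open>a\<close> keeps \<open>Max\<close>
  defined.\<close>

lemma finite_set_gap:
  fixes a b :: "'b::linorder"
  assumes "a < b" and fin: "finite (S \<inter> {a<..<b})"
  obtains c where "a \<le> c" "c < b" "S \<inter> {c<..<b} = {}"
proof
  let ?T = "insert a (S \<inter> {a<..<b})"
  have T: "finite ?T" "?T \<noteq> {}" using fin by auto
  show a: "a \<le> Max ?T" using T by simp
  show "Max ?T < b" using Max_in[OF T] \<open>a < b\<close> by auto
  show "S \<inter> {Max ?T<..<b} = {}"
  proof (rule equals0I)
    fix y assume y: "y \<in> S \<inter> {Max ?T<..<b}"
    then have "y \<in> ?T" using a by auto
    then have "y \<le> Max ?T" by (rule Max_ge[OF T(1)])
    with y show False by auto
  qed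
qed

lemma monotone_image_gap:
  fixes f :: "nat \<Rightarrow> 'b::linorder"
  assumes mono: "mono_on X f \<or> antimono_on X f" and "a < b"
  obtains c d where "a \<le> c" "c < d" "d \<le> b" "f ` X \<inter> {c<..<d} = {}"
proof (cases "f ` X \<inter> {a<..<b} = {}")
  case True
  with \<open>a < b\<close> show ?thesis using that[of a b] by simp
next
  case False
  then obtain x where x: "x \<in> X" "a < f x" "f x < b" by auto
  from mono show ?thesis
  proof
    assume m: "mono_on X f"
    \<comment> \<open>In the increasing case the side below \<open>f x\<close> is the sparse one:
      its values come only from the finitely many naturals below \<open>x\<close>.\<close>
    have "y < x" if "y \<in> X" "f y < f x" for y
      using m x(1) that by (meson linorder_not_less monotone_onD)
    then have "f ` X \<inter> {a<..<f x} \<subseteq> f ` {..<x}" by auto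
    then have "finite (f ` X \<inter> {a<..<f x})" by (rule finite_subset) simp
    then obtain c where "a \<le> c" "c < f x" "f ` X \<inter> {c<..<f x} = {}"
      using x(2) finite_set_gap by metis
    with x(3) show ?thesis using that[of c "f x"] by simp
  next
    assume m: "antimono_on X f"
    \<comment> \<open>In the decreasing case the sparse side lies above \<open>f x\<close>.\<close>
    have "y < x" if "y \<in> X" "f x < f y" for y
      using m x(1) that by (meson linorder_not_less monotone_onD)
    then have "f ` X \<inter> {f x<..<b} \<subseteq> f ` {..<x}" by auto
    then have "finite (f ` X \<inter> {f x<..<b})" by (rule finite_subset) simp
    then obtain c where "f x \<le> c" "c < b" "f ` X \<inter> {c<..<b} = {}"
      using x(3) finite_set_gap by metis
    with x(2) show ?thesis using that[of c b] by simp
  qed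
qed

text \<open>Gaps are nested: each further set shrinks the current gap to a subinterval, which still
  misses the earlier images. The induction starts from the interval between \<open>a\<close> and
  \<open>b\<close>.\<close>

lemma finitely_many_monotone_images_gap:
  fixes f :: "nat \<Rightarrow> 'b::linorder" and a b :: 'b
  assumes "finite I" and "\<And>i. i \<in> I \<Longrightarrow> mono_on (X i) f \<or> antimono_on (X i) f"
    and "a < b"
  shows "\<exists>c d. c < d \<and> f ` (\<Union>i\<in>I. X i) \<inter> {c<..<d} = {}"
  using assms(1,2)
proof (induction I rule: finite_induct)
  case empty
  from \<open>a < b\<close> show ?case by auto
next
  case (insert j I)
  then obtain c d where cd: "c < d" "f ` (\<Union>i\<in>I. X i) \<inter> {c<..<d} = {}" by auto
  obtain c' d' where *: "c \<le> c'" "c' < d'" "d' \<le> d" "f ` X j \<inter> {c'<..<d'} = {}"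
    using insert.prems[of j] cd(1) monotone_image_gap[of "X j" f c d] by auto
  have "{c'<..<d'} \<subseteq> {c<..<d}" using * by auto
  with cd(2) *(4) have "f ` (\<Union>i\<in>insert j I. X i) \<inter> {c'<..<d'} = {}"
    unfolding UN_insert image_Un by blast
  with *(2) show ?case by blast
qed

theorem theorem2:
  fixes f :: "nat \<Rightarrow> rat"
  assumes "f ` {1..} = UNIV"
  shows "\<forall>k::nat. k \<ge> 1 \<longrightarrow> \<not> k_monotonic_on k {1..} f"
proof (intro allI impI notI)
  fix k :: nat
  assume "k_monotonic_on k {1..} f"
  then obtain X :: "nat \<Rightarrow> nat set" where X: "{1..} = (\<Union>i\<in>{1..k}. X i)"
    "\<And>i. i \<in> {1..k} \<Longrightarrow> mono_on (X i) f \<or> antimono_on (X i) f"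
    unfolding k_monotonic_on_def by blast
  have "\<exists>c d. c < d \<and> f ` (\<Union>i\<in>{1..k}. X i) \<inter> {c<..<d} = {}"
    \<comment> \<open>The starting interval is the one from 0 to 1 in the rationals.\<close>
    by (rule finitely_many_monotone_images_gap[OF _ X(2) zero_less_one]) simp_all
  then obtain c d where "c < d" "f ` {1..} \<inter> {c<..<d} = {}"
    unfolding X(1)[symmetric] by blast
  \<comment> \<open>Density makes the gap nonempty, so surjectivity fails at
    \<open>q\<close>.\<close>
  moreover obtain q where "c < q" "q < d" using dense[OF \<open>c < d\<close>] by blast
  ultimately show False using assms by auto
qed

end
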